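(* Let $S$ be a set of sorts and $\Sigma$ an $S$-sorted signature such that, for every $S$-sorted set $A$, the support $\{s\in S\mid \mathrm{T}_\Sigma(A)_s\neq\varnothing\}$ of the free $\Sigma$-algebra $\mathbf{T}_\Sigma(A)$ is finite (equivalently, $S$ is finite). Then the ordered set $\mathbf{Form}_{\mathrm{Lang_r}}(\Sigma)$ of all formations of regular languages with respect to $\Sigma$, ordered pointwise by inclusion, is an algebraic lattice.
   Context: Fix a Grothendieck universe $\mathcal{U}$, a set of sorts $S\in\mathcal{U}$ and an $S$-sorted signature $\Sigma$, i.e. a family of sets $\Sigma_{w,s}\in\mathcal{U}$ indexed by $w\in S^{\star}$ (finite words on $S$) and $s\in S$. An $S$-sorted set is a family $A=(A_s)_{s\in S}$ of sets in $\mathcal{U}$ (components may be empty); it is finite if $\coprod_{s\in S}A_s$ is finite; $\mathcal{U}^S$ is the set of all $S$-sorted sets. Subsets, intersections, etc. are componentwise. A $\Sigma$-algebra $\mathbf{A}$ is an $S$-sorted set $A$ with an operation $F_\sigma\colon A_w=\prod_{i<|w|}A_{w_i}\to A_s$ for each $\sigma\in\Sigma_{w,s}$. Homomorphisms are $S$-sorted mappings commuting with all operations; epimorphism means homomorphism surjective in each sort. A congruence on $\mathbf{A}$ is a family $\Phi=(\Phi_s)_{s\in S}$ of equivalence relations on the $A_s$ compatible with all operations; it is of finite index if $A/\Phi$ is finite; $\mathrm{pr}^\Phi\colon\mathbf{A}\to\mathbf{A}/\Phi$ is the projection; $\nabla^{\mathbf{A}}$ is the greatest congruence; $\mathrm{Ker}(f)$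 is the kernel congruence of $f$. $\mathbf{T}_\Sigma(A)$ is the free $\Sigma$-algebra on $A$, with underlying $S$-sorted set $\mathrm{T}_\Sigma(A)$. For a congruence $\Phi$ on $\mathbf{A}$, $L\subseteq A$ is $\Phi$-saturated if each $L_s$ is a union of $\Phi_s$-classes; $\Phi\text{-}\mathrm{Sat}(A)$ is the set of $\Phi$-saturated subsets. $\Omega^{\mathbf{A}}(L)$ is the greatest congruence on $\mathbf{A}$ for which $L$ is saturated. $L\subseteq A$ is regular if $\Omega^{\mathbf{A}}(L)$ is of finite index; $\mathrm{Lang_r}(\mathbf{A})$ is the set of regular $L\subseteq A$. A formation of regular languages with respect to $\Sigma$ is a function $\mathcal{L}$ on $\mathcal{U}^S$ with $\mathcal{L}(A)\subseteq\mathrm{Lang_r}(\mathbf{T}_\Sigma(A))$ for all $A$ such that: (1) for every $A$, $\nabla^{\mathbf{T}_\Sigma(A)}\text{-}\mathrm{Sat}(\mathrm{T}_\Sigma(A))\subseteq\mathcal{L}(A)$; (2) for every $A$ and $L,L'\in\mathcal{L}(A)$, $(\Omega^{\mathbf{T}_\Sigma(A)}(L)\cap\Omega^{\mathbf{T}_\Sigma(A)}(L'))\text{-}\mathrm{Sat}(\mathrm{T}_\Sigma(A))\subseteq\mathcal{L}(A)$; (3) for all $A,B$, $M\in\mathcal{L}(B)$ and homomorphisms $f\colon\mathbf{T}_\Sigma(A)\to\mathbf{T}_\Sigma(B)$, if $\mathrm{pr}^{\Omega^{\mathbf{T}_\Sigma(B)}(M)}\circ f$ is an epimorphism, then $\mathrm{Ker}(\mathrm{pr}^{\Omega^{\mathbf{T}_\Sigma(B)}(M)}\circ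 f)\text{-}\mathrm{Sat}(\mathrm{T}_\Sigma(A))\subseteq\mathcal{L}(A)$. Order: $\mathcal{L}\le\mathcal{M}$ iff $\mathcal{L}(A)\subseteq\mathcal{M}(A)$ for all $A$. An algebraic lattice is a complete lattice in which every element is a join of compact elements. *)

theory Defs
  imports "HOL-Algebra.Complete_Lattice"
begin

section \<open>Universe and sorted sets\<close>

text \<open>
  A Grothendieck universe is represented by the type \<open>'u\<close> of its members together with the map
  sending a member to the HOL set of its elements, which are again members (so transitivity is
  built in).  A HOL set \<open>X :: 'u set\<close> is then (the extension of) a member of the universe iff
  \<open>X \<in> range elts\<close>.  The clauses are extensionality, foundation, and closure under pairing, full
  power sets, and unions of families indexed by a member.  Membership of \<open>\<omega>\<close> is not required, so
  both usual conventions are covered.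
\<close>

definition grothendieck_universe :: "('u \<Rightarrow> 'u set) \<Rightarrow> bool" where
  "grothendieck_universe elts \<longleftrightarrow>
     inj elts \<and>
     wf {(x, y). x \<in> elts y} \<and>
     (\<forall>x y. {x, y} \<in> range elts) \<and>
     (\<forall>x. \<exists>p. elts ` elts p = Pow (elts x)) \<and>
     (\<forall>x f. (\<Union>i\<in>elts x. elts (f i)) \<in> range elts)"

text \<open>
  Families indexed by a set of sorts \<open>S :: 's set\<close> are functions on \<open>'s\<close> that are empty outside
  \<open>S\<close>, so that equality of functions is equality of families.
\<close>

definition off_empty :: "'s set \<Rightarrow> ('s \<Rightarrow> 'a set) \<Rightarrow> bool" where
  "off_empty S X \<longleftrightarrow> (\<forall>s. s \<notin> S \<longrightarrow> X s = {})"

definition sorted_sets :: "'x set set \<Rightarrow> 's set \<Rightarrow> ('s \<Rightarrow> 'x set) set" where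
  "sorted_sets U S = {A. off_empty S A \<and> (\<forall>s\<in>S. A s \<in> U)}"

definition sorted_finite :: "'s set \<Rightarrow> ('s \<Rightarrow> 'a set) \<Rightarrow> bool" where
  "sorted_finite S X \<longleftrightarrow> finite (Sigma S X)"

definition support :: "'s set \<Rightarrow> ('s \<Rightarrow> 'a set) \<Rightarrow> 's set" where
  "support S X = {s \<in> S. X s \<noteq> {}}"

definition sorted_subsets :: "'s set \<Rightarrow> ('s \<Rightarrow> 'a set) \<Rightarrow> ('s \<Rightarrow> 'a set) set" where
  "sorted_subsets S X = {L. off_empty S L \<and> (\<forall>s\<in>S. L s \<subseteq> X s)}"

definition tuples :: "('s \<Rightarrow> 'a set) \<Rightarrow> 's list \<Rightarrow> 'a list set" where
  "tuples X w = {xs. list_all2 (\<lambda>i x. x \<in> X i) w xs}"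


section \<open>Many-sorted algebras\<close>

text \<open>
  A signature is a family \<open>Sg :: 's list \<Rightarrow> 's \<Rightarrow> 'o set\<close>.  The sets \<open>Sg w s\<close> need not be disjoint,
  hence the operation interpreting \<open>\<sigma> \<in> Sg w s\<close> is indexed by \<open>w\<close>, \<open>s\<close> and \<open>\<sigma>\<close>.
\<close>

record ('s, 'o, 'a) alg =
  under :: "'s \<Rightarrow> 'a set"
  oper :: "'s list \<Rightarrow> 's \<Rightarrow> 'o \<Rightarrow> 'a list \<Rightarrow> 'a"

definition homomorphism ::
  "'s set \<Rightarrow> ('s list \<Rightarrow> 's \<Rightarrow> 'o set) \<Rightarrow> ('s, 'o, 'a) alg \<Rightarrow> ('s, 'o, 'b) alg \<Rightarrow> ('s \<Rightarrow> 'a \<Rightarrow> 'b) \<Rightarrow> bool"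
  where
  "homomorphism S Sg A B f \<longleftrightarrow>
     (\<forall>s\<in>S. f s \<in> under A s \<rightarrow> under B s) \<and>
     (\<forall>w\<in>lists S. \<forall>s\<in>S. \<forall>\<sigma>\<in>Sg w s. \<forall>xs\<in>tuples (under A) w.
        f s (oper A w s \<sigma> xs) = oper B w s \<sigma> (map2 f w xs))"

definition epimorphism ::
  "'s set \<Rightarrow> ('s list \<Rightarrow> 's \<Rightarrow> 'o set) \<Rightarrow> ('s, 'o, 'a) alg \<Rightarrow> ('s, 'o, 'b) alg \<Rightarrow> ('s \<Rightarrow> 'a \<Rightarrow> 'b) \<Rightarrow> bool"
  where
  "epimorphism S Sg A B f \<longleftrightarrow>
     homomorphism S Sg A B f \<and> (\<forall>s\<in>S. f s ` under A s = under B s)"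

definition is_congruence ::
  "'s set \<Rightarrow> ('s list \<Rightarrow> 's \<Rightarrow> 'o set) \<Rightarrow> ('s, 'o, 'a) alg \<Rightarrow> ('s \<Rightarrow> ('a \<times> 'a) set) \<Rightarrow> bool" where
  "is_congruence S Sg A \<Phi> \<longleftrightarrow>
     off_empty S \<Phi> \<and>
     (\<forall>s\<in>S. equiv (under A s) (\<Phi> s)) \<and>
     (\<forall>w\<in>lists S. \<forall>s\<in>S. \<forall>\<sigma>\<in>Sg w s. \<forall>xs\<in>tuples (under A) w. \<forall>ys\<in>tuples (under A) w.
        (\<forall>i<length w. (xs ! i, ys ! i) \<in> \<Phi> (w ! i)) \<longrightarrow>
        (oper A w s \<sigma> xs, oper A w s \<sigma> ys) \<in> \<Phi> s)"

text \<open>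
  For a congruence, the union in the quotient operation below ranges over one and the same class
  for all choices of representatives.
\<close>

definition quotient_alg ::
  "('s, 'o, 'a) alg \<Rightarrow> ('s \<Rightarrow> ('a \<times> 'a) set) \<Rightarrow> ('s, 'o, 'a set) alg" where
  "quotient_alg A \<Phi> =
     \<lparr>under = (\<lambda>s. under A s // \<Phi> s),
      oper = (\<lambda>w s \<sigma> Xs. \<Union>xs\<in>{xs. list_all2 (\<in>) xs Xs}. \<Phi> s `` {oper A w s \<sigma> xs})\<rparr>"

definition proj :: "('s \<Rightarrow> ('a \<times> 'a) set) \<Rightarrow> 's \<Rightarrow> 'a \<Rightarrow> 'a set" where
  "proj \<Phi> s x = \<Phi> s `` {x}"

definition finite_index :: "'s set \<Rightarrow> ('s, 'o, 'a) alg \<Rightarrow> ('s \<Rightarrow> ('a \<times> 'a) set) \<Rightarrow> bool" where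
  "finite_index S A \<Phi> \<longleftrightarrow> sorted_finite S (under (quotient_alg A \<Phi>))"

definition Ker :: "'s set \<Rightarrow> ('s, 'o, 'a) alg \<Rightarrow> ('s \<Rightarrow> 'a \<Rightarrow> 'b) \<Rightarrow> 's \<Rightarrow> ('a \<times> 'a) set" where
  "Ker S A f s = {(x, y). s \<in> S \<and> x \<in> under A s \<and> y \<in> under A s \<and> f s x = f s y}"

definition saturated ::
  "'s set \<Rightarrow> ('s, 'o, 'a) alg \<Rightarrow> ('s \<Rightarrow> ('a \<times> 'a) set) \<Rightarrow> ('s \<Rightarrow> 'a set) \<Rightarrow> bool" where
  "saturated S A \<Phi> L \<longleftrightarrow> (\<forall>s\<in>S. \<exists>C. C \<subseteq> under A s // \<Phi> s \<and> L s = \<Union>C)"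

definition Sat ::
  "'s set \<Rightarrow> ('s, 'o, 'a) alg \<Rightarrow> ('s \<Rightarrow> ('a \<times> 'a) set) \<Rightarrow> ('s \<Rightarrow> 'a set) set" where
  "Sat S A \<Phi> = {L \<in> sorted_subsets S (under A). saturated S A \<Phi> L}"

definition greatest_congruence ::
  "'s set \<Rightarrow> ('s list \<Rightarrow> 's \<Rightarrow> 'o set) \<Rightarrow> ('s, 'o, 'a) alg \<Rightarrow> (('s \<Rightarrow> ('a \<times> 'a) set) \<Rightarrow> bool) \<Rightarrow>
     's \<Rightarrow> ('a \<times> 'a) set" where
  "greatest_congruence S Sg A P =
     (THE \<Phi>. is_congruence S Sg A \<Phi> \<and> P \<Phi> \<and>
        (\<forall>\<Psi>. is_congruence S Sg A \<Psi> \<and> P \<Psi> \<longrightarrow> (\<forall>s\<in>S. \<Psi> s \<subseteq> \<Phi> s)))"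

definition nabla ::
  "'s set \<Rightarrow> ('s list \<Rightarrow> 's \<Rightarrow> 'o set) \<Rightarrow> ('s, 'o, 'a) alg \<Rightarrow> 's \<Rightarrow> ('a \<times> 'a) set" where
  "nabla S Sg A = greatest_congruence S Sg A (\<lambda>_. True)"

definition Omega ::
  "'s set \<Rightarrow> ('s list \<Rightarrow> 's \<Rightarrow> 'o set) \<Rightarrow> ('s, 'o, 'a) alg \<Rightarrow> ('s \<Rightarrow> 'a set) \<Rightarrow> 's \<Rightarrow> ('a \<times> 'a) set"
  where
  "Omega S Sg A L = greatest_congruence S Sg A (\<lambda>\<Phi>. saturated S A \<Phi> L)"

definition Lang_r ::
  "'s set \<Rightarrow> ('s list \<Rightarrow> 's \<Rightarrow> 'o set) \<Rightarrow> ('s, 'o, 'a) alg \<Rightarrow> ('s \<Rightarrow> 'a set) set" where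
  "Lang_r S Sg A = {L \<in> sorted_subsets S (under A). finite_index S A (Omega S Sg A L)}"


section \<open>The free algebra\<close>

text \<open>
  The free algebra on a sorted set is the algebra of well-sorted terms.  Variables carry their
  sort because the components of a sorted set need not be disjoint.
\<close>

datatype ('s, 'o, 'x) trm = Var 's 'x | Op "'s list" 's 'o "('s, 'o, 'x) trm list"

inductive has_sort ::
  "'s set \<Rightarrow> ('s list \<Rightarrow> 's \<Rightarrow> 'o set) \<Rightarrow> ('s \<Rightarrow> 'x set) \<Rightarrow> 's \<Rightarrow> ('s, 'o, 'x) trm \<Rightarrow> bool"
  for S Sg X where
  Var: "s \<in> S \<Longrightarrow> x \<in> X s \<Longrightarrow> has_sort S Sg X s (Var s x)"
| Op: "w \<in> lists S \<Longrightarrow> s \<in> S \<Longrightarrow> \<sigma> \<in> Sg w s \<Longrightarrow> list_all2 (has_sort S Sg X) w ts \<Longrightarrow>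
    has_sort S Sg X s (Op w s \<sigma> ts)"

definition free_alg ::
  "'s set \<Rightarrow> ('s list \<Rightarrow> 's \<Rightarrow> 'o set) \<Rightarrow> ('s \<Rightarrow> 'x set) \<Rightarrow> ('s, 'o, ('s, 'o, 'x) trm) alg" where
  "free_alg S Sg X = \<lparr>under = (\<lambda>s. {t. has_sort S Sg X s t}), oper = Op\<rparr>"


section \<open>Formations of regular languages\<close>

text \<open>
  A formation is a function on \<open>sorted_sets U S\<close>; as usual for functions with a restricted domain
  in HOL it is required to be \<open>extensional\<close> there.
\<close>

definition formations ::
  "'x set set \<Rightarrow> 's set \<Rightarrow> ('s list \<Rightarrow> 's \<Rightarrow> 'o set) \<Rightarrow>
     (('s \<Rightarrow> 'x set) \<Rightarrow> ('s \<Rightarrow> ('s, 'o, 'x) trm set) set) set" where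
  "formations U S Sg =
     {\<L> \<in> extensional (sorted_sets U S).
       (\<forall>A\<in>sorted_sets U S. \<L> A \<subseteq> Lang_r S Sg (free_alg S Sg A)) \<and>
       (\<forall>A\<in>sorted_sets U S. Sat S (free_alg S Sg A) (nabla S Sg (free_alg S Sg A)) \<subseteq> \<L> A) \<and>
       (\<forall>A\<in>sorted_sets U S. \<forall>L\<in>\<L> A. \<forall>L'\<in>\<L> A.
          Sat S (free_alg S Sg A)
            (\<lambda>s. Omega S Sg (free_alg S Sg A) L s \<inter> Omega S Sg (free_alg S Sg A) L' s) \<subseteq> \<L> A) \<and>
       (\<forall>A\<in>sorted_sets U S. \<forall>B\<in>sorted_sets U S. \<forall>M\<in>\<L> B. \<forall>f.
          homomorphism S Sg (free_alg S Sg A) (free_alg S Sg B) f \<longrightarrow>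
          (let \<Phi> = Omega S Sg (free_alg S Sg B) M; g = (\<lambda>s. proj \<Phi> s \<circ> f s) in
           epimorphism S Sg (free_alg S Sg A) (quotient_alg (free_alg S Sg B) \<Phi>) g \<longrightarrow>
           Sat S (free_alg S Sg A) (Ker S (free_alg S Sg A) g) \<subseteq> \<L> A))}"

definition Form ::
  "'x set set \<Rightarrow> 's set \<Rightarrow> ('s list \<Rightarrow> 's \<Rightarrow> 'o set) \<Rightarrow>
     (('s \<Rightarrow> 'x set) \<Rightarrow> ('s \<Rightarrow> ('s, 'o, 'x) trm set) set) gorder" where
  "Form U S Sg =
     \<lparr>carrier = formations U S Sg, eq = (=),
      le = (\<lambda>\<L> \<M>. \<forall>A\<in>sorted_sets U S. \<L> A \<subseteq> \<M> A)\<rparr>"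


section \<open>Algebraic lattices\<close>

definition compact_element :: "('a, 'b) gorder_scheme \<Rightarrow> 'a \<Rightarrow> bool" where
  "compact_element L c \<longleftrightarrow>
     c \<in> carrier L \<and>
     (\<forall>A. A \<subseteq> carrier L \<and> c \<sqsubseteq>\<^bsub>L\<^esub> \<Squnion>\<^bsub>L\<^esub>A \<longrightarrow>
        (\<exists>F. F \<subseteq> A \<and> finite F \<and> c \<sqsubseteq>\<^bsub>L\<^esub> \<Squnion>\<^bsub>L\<^esub>F))"

definition algebraic_lattice :: "('a, 'b) gorder_scheme \<Rightarrow> bool" where
  "algebraic_lattice L \<longleftrightarrow>
     complete_lattice L \<and>
     (\<forall>x\<in>carrier L. \<exists>K. K \<subseteq> {c. compact_element L c} \<and> x = \<Squnion>\<^bsub>L\<^esub>K)"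

end

theory Submission
  imports Defs
begin

text \<open>
  All conditions on a formation are closure conditions with finitely many premises, so formations
  are closed under pointwise intersections of nonempty families and under pointwise unions of
  directed families.  The greatest formation consists of all regular languages; finiteness of the
  supports is what makes the languages saturated for the greatest congruence regular.  In such a
  system of set-valued functions the least member containing a given point is compact, and
  every member is the join of those belonging to its points.
\<close>

section \<open>Algebraic closure systems of set-valued functions\<close>

text \<open>Meets of nonempty families together with the greatest element \<open>T\<close>, which
  serves as the empty meet, give completeness. Closure under directed unions makes a join the
  pointwise union of the joins of its finite subfamilies, and compactness of the point-generated
  members follows from that.\<close>

lemma algebraic_lattice_pointwise:
  fixes C :: "('i \<Rightarrow> 'b set) set" and I :: "'i set"
  defines "P \<equiv> \<lparr>carrier = C, eq = (=), le = (\<lambda>x y. \<forall>i\<in>I. x i \<subseteq> y i)\<rparr>"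
  assumes ext: "C \<subseteq> extensional I"
    and top: "T \<in> C" "\<And>x i. x \<in> C \<Longrightarrow> i \<in> I \<Longrightarrow> x i \<subseteq> T i"
    and inter: "\<And>X. X \<subseteq> C \<Longrightarrow> X \<noteq> {} \<Longrightarrow> (\<lambda>i\<in>I. \<Inter>x\<in>X. x i) \<in> C"
    and directed: "\<And>X. X \<subseteq> C \<Longrightarrow> X \<noteq> {} \<Longrightarrow>
      (\<And>x y. x \<in> X \<Longrightarrow> y \<in> X \<Longrightarrow> \<exists>z\<in>X. \<forall>i\<in>I. x i \<subseteq> z i \<and> y i \<subseteq> z i) \<Longrightarrow>
      (\<lambda>i\<in>I. \<Union>x\<in>X. x i) \<in> C"
  shows "algebraic_lattice P"
proof -
  have car: "carrier P = C" and le: "\<And>x y. x \<sqsubseteq>\<^bsub>P\<^esub> y \<longleftrightarrow> (\<forall>i\<in>I. x i \<subseteq> y i)"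
    by (simp_all add: P_def)
  \<comment> \<open>The order compares values on \<open>I\<close> only; extensionality settles
    equality elsewhere.\<close>
  have antisym: "x = y" if "x \<in> C" "y \<in> C" "x \<sqsubseteq>\<^bsub>P\<^esub> y" "y \<sqsubseteq>\<^bsub>P\<^esub> x" for x y
    using that ext unfolding le by (intro extensionalityI[of x I y]) blast+
  have po: "partial_order P"
    by unfold_locales (use antisym in \<open>(simp add: P_def, blast?)+\<close>)
  interpret partial_order P by (rule po)
  have cl: "complete_lattice P"
  proof (rule complete_lattice_criterion1)
    show "\<exists>g. greatest P g (carrier P)"
      using top by (auto simp: greatest_def car le intro!: exI[of _ T])
  next
    fix X assume X: "X \<subseteq> carrier P" "X \<noteq> {}"
    have "greatest P (\<lambda>i\<in>I. \<Inter>x\<in>X. x i) (Lower P X)"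
      using inter[of X] X unfolding greatest_def Lower_def car le by (auto 4 4)
    then show "\<exists>i. greatest P i (Lower P X)" by (intro exI)
  qed
  interpret complete_lattice P by (rule cl)
  have sup_in: "\<Squnion>\<^bsub>P\<^esub>X \<in> C" if "X \<subseteq> C" for X
    using that sup_closed[of X] by (simp add: car)
  have upper: "x i \<subseteq> (\<Squnion>\<^bsub>P\<^esub>X) i" if "X \<subseteq> C" "x \<in> X" "i \<in> I" for x X i
    using that sup_upper[of X x] by (auto simp: car le)
  have least: "(\<Squnion>\<^bsub>P\<^esub>X) i \<subseteq> y i" if "X \<subseteq> C" "y \<in> C" "i \<in> I" "\<And>x j. x \<in> X \<Longrightarrow> j \<in> I \<Longrightarrow> x j \<subseteq> y j" for X y i
    using that sup_least[of X y] by (auto simp: car le Upper_def)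
  have finitary: "\<exists>F\<subseteq>X. finite F \<and> a \<in> (\<Squnion>\<^bsub>P\<^esub>F) i" if X: "X \<subseteq> C" and i: "i \<in> I" and a: "a \<in> (\<Squnion>\<^bsub>P\<^esub>X) i" for X i a
  proof -
    \<comment> \<open>The joins of finite subfamilies form a directed family, with the join over
      \<open>F \<union> G\<close> above those over \<open>F\<close> and \<open>G\<close>. It is
      nonempty even for empty \<open>X\<close>, because \<open>F = {}\<close> is allowed.\<close>
    define D where "D = {\<Squnion>\<^bsub>P\<^esub>F | F. F \<subseteq> X \<and> finite F}"
    have "(\<lambda>i\<in>I. \<Union>x\<in>D. x i) \<in> C"
    proof (rule directed)
      show "D \<subseteq> C" using X sup_in by (auto simp: D_def)
      show "D \<noteq> {}" by (auto simp: D_def)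
      fix x y assume "x \<in> D" "y \<in> D"
      then obtain F G where FG: "F \<subseteq> X" "finite F" "x = \<Squnion>\<^bsub>P\<^esub>F" "G \<subseteq> X" "finite G" "y = \<Squnion>\<^bsub>P\<^esub>G"
        by (auto simp: D_def)
      have FGC: "F \<subseteq> C" "G \<subseteq> C" "F \<union> G \<subseteq> C" using FG X by auto
      have "x i \<subseteq> (\<Squnion>\<^bsub>P\<^esub>(F \<union> G)) i" "y i \<subseteq> (\<Squnion>\<^bsub>P\<^esub>(F \<union> G)) i" if "i \<in> I" for i
        unfolding FG(3,6) using FGC that by (intro least sup_in upper; simp)+
      then show "\<exists>z\<in>D. \<forall>i\<in>I. x i \<subseteq> z i \<and> y i \<subseteq> z i"
        using FG by (intro bexI[of _ "\<Squnion>\<^bsub>P\<^esub>(F \<union> G)"]) (auto simp: D_def)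
    qed
    \<comment> \<open>Singleton subfamilies show that the union of \<open>D\<close> bounds
      \<open>X\<close> from above, so the join of \<open>X\<close> lies below this union.\<close>
    moreover have "x j \<subseteq> (\<lambda>i\<in>I. \<Union>x\<in>D. x i) j" if "x \<in> X" "j \<in> I" for x j
    proof -
      have "\<Squnion>\<^bsub>P\<^esub>{x} \<in> D" using that by (auto simp: D_def)
      moreover have "x j \<subseteq> (\<Squnion>\<^bsub>P\<^esub>{x}) j" using that X by (intro upper) auto
      ultimately show ?thesis using that by auto
    qed
    ultimately have "(\<Squnion>\<^bsub>P\<^esub>X) i \<subseteq> (\<lambda>i\<in>I. \<Union>x\<in>D. x i) i"
      using X i by (intro least)
    then show ?thesis using a i by (auto simp: D_def)
  qed
  \<comment> \<open>The least member with \<open>a\<close> in its value at \<open>i\<close>,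
    provided some member has \<open>a\<close> there; that member makes the intersected family
    nonempty, as \<open>inter\<close> requires.\<close>
  define c where "c i a = (\<lambda>j\<in>I. \<Inter>x\<in>{x \<in> C. a \<in> x i}. x j)" for i a
  have c_in: "c i a \<in> C" if "x \<in> C" "a \<in> x i" for i a x
    unfolding c_def using that by (intro inter) auto
  have c_mem: "a \<in> c i a i" if "i \<in> I" for i a
    using that by (simp add: c_def)
  have c_le: "c i a j \<subseteq> x j" if "x \<in> C" "a \<in> x i" "j \<in> I" for i a x j
    using that by (auto simp: c_def)
  \<comment> \<open>For \<open>y\<close> in \<open>C\<close>, \<open>c i a\<close> lies below
    \<open>y\<close> exactly when \<open>a \<in> y i\<close>, so compactness is
    \<open>finitary\<close> applied to the point \<open>a\<close>.\<close>
  have comp: "compact_element P (c i a)" if "x \<in> C" "i \<in> I" "a \<in> x i" for x i a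
    unfolding compact_element_def
  proof (intro conjI allI impI)
    show "c i a \<in> carrier P" using c_in that by (simp add: car)
    fix A assume "A \<subseteq> carrier P \<and> c i a \<sqsubseteq>\<^bsub>P\<^esub> \<Squnion>\<^bsub>P\<^esub>A"
    then have A: "A \<subseteq> C" "a \<in> (\<Squnion>\<^bsub>P\<^esub>A) i"
      using c_mem[OF \<open>i \<in> I\<close>, of a] \<open>i \<in> I\<close> by (auto simp: car le)
    from finitary[OF A(1) \<open>i \<in> I\<close> A(2)]
    obtain F where F: "F \<subseteq> A" "finite F" "a \<in> (\<Squnion>\<^bsub>P\<^esub>F) i" by blast
    have "\<Squnion>\<^bsub>P\<^esub>F \<in> C" using F(1) A(1) by (intro sup_in) blast
    then have "c i a \<sqsubseteq>\<^bsub>P\<^esub> \<Squnion>\<^bsub>P\<^esub>F" unfolding le using c_le F(3) by blast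
    then show "\<exists>F. F \<subseteq> A \<and> finite F \<and> c i a \<sqsubseteq>\<^bsub>P\<^esub> \<Squnion>\<^bsub>P\<^esub>F"
      using F by blast
  qed
  show ?thesis
    unfolding algebraic_lattice_def
  proof (intro conjI ballI cl)
    fix x assume "x \<in> carrier P"
    then have x: "x \<in> C" by (simp add: car)
    define K where "K = {c i a | i a. i \<in> I \<and> a \<in> x i}"
    have KC: "K \<subseteq> C" using c_in x by (auto simp: K_def)
    have "\<Squnion>\<^bsub>P\<^esub>K \<sqsubseteq>\<^bsub>P\<^esub> x"
      unfolding le by (intro ballI least[OF KC x]) (use c_le[OF x] in \<open>auto simp only: K_def\<close>)
    moreover have "x i \<subseteq> (\<Squnion>\<^bsub>P\<^esub>K) i" if "i \<in> I" for i
    proof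
      fix a assume "a \<in> x i"
      then have "c i a \<in> K" using that by (auto simp: K_def)
      from upper[OF KC this that] show "a \<in> (\<Squnion>\<^bsub>P\<^esub>K) i" using c_mem[OF that, of a] by blast
    qed
    ultimately have "x = \<Squnion>\<^bsub>P\<^esub>K"
      using antisym[of x "\<Squnion>\<^bsub>P\<^esub>K"] x sup_in[OF KC] by (auto simp: le)
    moreover have "K \<subseteq> {c. compact_element P c}" using comp x by (auto simp: K_def)
    ultimately show "\<exists>K. K \<subseteq> {c. compact_element P c} \<and> x = \<Squnion>\<^bsub>P\<^esub>K" by blast
  qed
qed


section \<open>Congruences and saturated sets\<close>

text \<open>The record \<open>alg\<close> does not force operations to stay in the carrier. Without
  this, even the identity and the full relation could fail to be congruences.\<close>

definition op_closed ::
  "'s set \<Rightarrow> ('s list \<Rightarrow> 's \<Rightarrow> 'o set) \<Rightarrow> ('s, 'o, 'a) alg \<Rightarrow> bool" where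
  "op_closed S Sg A \<longleftrightarrow>
     (\<forall>w\<in>lists S. \<forall>s\<in>S. \<forall>\<sigma>\<in>Sg w s. \<forall>xs\<in>tuples (under A) w. oper A w s \<sigma> xs \<in> under A s)"

lemma op_closed_free_alg: "op_closed S Sg (free_alg S Sg X)"
  unfolding op_closed_def free_alg_def tuples_def by (auto intro!: has_sort.Op)

text \<open>Turns the existence of a set of classes into a closure condition, which can be followed
  along chains of related elements.\<close>

lemma saturated_iff:
  assumes "is_congruence S Sg A \<Phi>"
  shows "saturated S A \<Phi> L \<longleftrightarrow> (\<forall>s\<in>S. L s \<subseteq> under A s \<and> \<Phi> s `` L s \<subseteq> L s)"
  unfolding saturated_def
proof (rule ball_cong[OF refl], rule iffI)
  fix s assume s: "s \<in> S"
  then have eq: "equiv (under A s) (\<Phi> s)" using assms by (simp add: is_congruence_def)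
  {
    assume "\<exists>C\<subseteq>under A s // \<Phi> s. L s = \<Union> C"
    then obtain C where C: "C \<subseteq> under A s // \<Phi> s" "L s = \<Union> C" by blast
    show "L s \<subseteq> under A s \<and> \<Phi> s `` L s \<subseteq> L s"
      unfolding C(2)
    proof (intro conjI subsetI)
      fix y assume "y \<in> \<Union> C"
      then show "y \<in> under A s" using C(1) in_quotient_imp_subset[OF eq] by blast
    next
      fix y assume "y \<in> \<Phi> s `` \<Union> C"
      then obtain X x where X: "X \<in> C" and x: "x \<in> X" "(x, y) \<in> \<Phi> s" by blast
      from X C(1) have "X \<in> under A s // \<Phi> s" by blast
      from in_quotient_imp_closed[OF eq this x] X show "y \<in> \<Union> C" by blast
    qed
  next
    assume L: "L s \<subseteq> under A s \<and> \<Phi> s `` L s \<subseteq> L s"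
    show "\<exists>C\<subseteq>under A s // \<Phi> s. L s = \<Union> C"
    proof (intro exI conjI)
      show "(\<lambda>x. \<Phi> s `` {x}) ` L s \<subseteq> under A s // \<Phi> s" using L by (auto intro: quotientI)
      show "L s = \<Union> ((\<lambda>x. \<Phi> s `` {x}) ` L s)"
      proof
        show "L s \<subseteq> \<Union> ((\<lambda>x. \<Phi> s `` {x}) ` L s)"
        proof
          fix x assume x: "x \<in> L s"
          then have "x \<in> under A s" using L by blast
          then have "x \<in> \<Phi> s `` {x}" by (rule equiv_class_self[OF eq])
          then show "x \<in> \<Union> ((\<lambda>x. \<Phi> s `` {x}) ` L s)" using x by (rule UN_I[rotated])
        qed
        show "\<Union> ((\<lambda>x. \<Phi> s `` {x}) ` L s) \<subseteq> L s" using L by fast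
      qed
    qed
  }
qed

text \<open>Justifies the definite description: two greatest candidates contain each other on
  \<open>S\<close>, and both are empty off \<open>S\<close>.\<close>

lemma greatest_congruence_eq:
  assumes "is_congruence S Sg A \<Phi>" "P \<Phi>"
    and "\<And>\<Psi> s. is_congruence S Sg A \<Psi> \<Longrightarrow> P \<Psi> \<Longrightarrow> s \<in> S \<Longrightarrow> \<Psi> s \<subseteq> \<Phi> s"
  shows "greatest_congruence S Sg A P = \<Phi>"
  unfolding greatest_congruence_def
proof (rule the_equality)
  fix \<Psi> assume \<Psi>: "is_congruence S Sg A \<Psi> \<and> P \<Psi> \<and>
    (\<forall>\<Psi>'. is_congruence S Sg A \<Psi>' \<and> P \<Psi>' \<longrightarrow> (\<forall>s\<in>S. \<Psi>' s \<subseteq> \<Psi> s))"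
  show "\<Psi> = \<Phi>"
  proof
    fix s
    show "\<Psi> s = \<Phi> s"
    proof (cases "s \<in> S")
      case True
      then show ?thesis using \<Psi> assms by blast
    next
      case False
      then show ?thesis using \<Psi> assms(1) by (simp add: is_congruence_def off_empty_def)
    qed
  qed
qed (use assms in blast)

section \<open>Joins of congruences and existence of the greatest saturating congruence\<close>

lemma tuples_iff: "xs \<in> tuples X w \<longleftrightarrow> length xs = length w \<and> (\<forall>i<length w. xs ! i \<in> X (w ! i))"
  by (auto simp: tuples_def list_all2_conv_all_nth)

text \<open>This is the join of the congruences in \<open>G\<close>. Chains in different arguments
  may differ in length and use different congruences, so compatibility is proved by changing one
  argument at a time, one link at a time. A member of \<open>G\<close> supplies reflexivity.\<close>

lemma is_congruence_trancl_Union: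
  assumes G: "\<And>\<Psi>. \<Psi> \<in> G \<Longrightarrow> is_congruence S Sg A \<Psi>" and ne: "G \<noteq> {}"
  shows "is_congruence S Sg A (\<lambda>s. (\<Union>\<Psi>\<in>G. \<Psi> s)\<^sup>+)"
proof -
  define Q where "Q s = (\<Union>\<Psi>\<in>G. \<Psi> s)" for s
  have off: "Q s = {}" if "s \<notin> S" for s
    using G that by (auto simp: Q_def is_congruence_def off_empty_def)
  have equ: "equiv (under A s) (\<Psi> s)" if "\<Psi> \<in> G" "s \<in> S" for s \<Psi>
    using G that by (simp add: is_congruence_def)
  have Qsub: "Q s \<subseteq> under A s \<times> under A s" if "s \<in> S" for s
    using equ[OF _ that] by (fastforce simp: Q_def equiv_def refl_on_def)
  have Tsub: "(Q s)\<^sup>+ \<subseteq> under A s \<times> under A s" if "s \<in> S" for s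
    using Qsub[OF that] by (rule trancl_subset_Sigma)
  have refl: "(x, x) \<in> (Q s)\<^sup>+" if "s \<in> S" "x \<in> under A s" for s x
    using ne equ[OF _ that(1)] that(2) by (fastforce simp: Q_def equiv_def refl_on_def)
  have symQ: "sym (Q s)" if "s \<in> S" for s
    using equ[OF _ that] unfolding Q_def equiv_def sym_def by blast
  have step: "(oper A w s \<sigma> zs, oper A w s \<sigma> (zs[k := y])) \<in> (Q s)\<^sup>+"
    if w: "w \<in> lists S" "s \<in> S" "\<sigma> \<in> Sg w s" and zs: "zs \<in> tuples (under A) w"
      and k: "k < length w" and y: "(zs ! k, y) \<in> (Q (w ! k))\<^sup>+" for w s \<sigma> zs k y
  proof -
    have inS: "w ! i \<in> S" if "i < length w" for i using w that by auto
    \<comment> \<open>A single link comes from one \<open>\<Psi>\<close> in \<open>G\<close>; the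
      unchanged arguments are related by reflexivity of that \<open>\<Psi>\<close>.\<close>
    have one: "(oper A w s \<sigma> (zs[k := u]), oper A w s \<sigma> (zs[k := v])) \<in> Q s"
      if uv: "(u, v) \<in> Q (w ! k)" for u v
    proof -
      from uv obtain \<Psi> where \<Psi>: "\<Psi> \<in> G" "(u, v) \<in> \<Psi> (w ! k)" by (auto simp: Q_def)
      have uvA: "u \<in> under A (w ! k)" "v \<in> under A (w ! k)" using Qsub[OF inS[OF k]] uv by auto
      have "zs[k := u] \<in> tuples (under A) w" "zs[k := v] \<in> tuples (under A) w"
        using zs uvA k by (auto simp: tuples_iff nth_list_update)
      moreover have "\<forall>i<length w. (zs[k := u] ! i, zs[k := v] ! i) \<in> \<Psi> (w ! i)"
        using zs k \<Psi> equ[OF \<Psi>(1) inS]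
        by (auto simp: tuples_iff nth_list_update equiv_def refl_on_def)
      ultimately have "(oper A w s \<sigma> (zs[k := u]), oper A w s \<sigma> (zs[k := v])) \<in> \<Psi> s"
        using G[OF \<Psi>(1)] w unfolding is_congruence_def by blast
      then show ?thesis using \<Psi>(1) by (auto simp: Q_def)
    qed
    from y show ?thesis
    proof (induction rule: trancl_induct)
      case (base y)
      then show ?case using one[of "zs ! k" y] by (simp add: r_into_trancl')
    next
      case (step y z)
      then show ?case using one[of y z] by (meson trancl.trancl_into_trancl)
    qed
  qed
  have comp: "(oper A w s \<sigma> xs, oper A w s \<sigma> ys) \<in> (Q s)\<^sup>+"
    if w: "w \<in> lists S" "s \<in> S" "\<sigma> \<in> Sg w s"
      and xs: "xs \<in> tuples (under A) w" and ys: "ys \<in> tuples (under A) w"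
      and xy: "\<forall>i<length w. (xs ! i, ys ! i) \<in> (Q (w ! i))\<^sup>+" for w s \<sigma> xs ys
  proof -
    \<comment> \<open>A transitive closure need not be reflexive, so the induction start, where
      nothing is replaced yet, takes its pair from some member of \<open>G\<close>.\<close>
    obtain \<Psi> where \<Psi>: "\<Psi> \<in> G" using ne by blast
    have "\<forall>i<length w. (xs ! i, xs ! i) \<in> \<Psi> (w ! i)"
      using xs equ[OF \<Psi>] w by (auto simp: tuples_iff equiv_def refl_on_def)
    then have base: "(oper A w s \<sigma> xs, oper A w s \<sigma> xs) \<in> \<Psi> s"
      using G[OF \<Psi>] w xs unfolding is_congruence_def by blast
    \<comment> \<open>Replace the arguments one position at a time.\<close>
    have "(oper A w s \<sigma> xs, oper A w s \<sigma> (take k ys @ drop k xs)) \<in> (Q s)\<^sup>+" if "k \<le> length w" for k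
      using that
    proof (induction k)
      case 0
      then show ?case using base \<Psi> by (auto simp: Q_def)
    next
      case (Suc k)
      let ?zs = "take k ys @ drop k xs"
      have len: "length xs = length w" "length ys = length w" using xs ys by (auto simp: tuples_iff)
      have "?zs \<in> tuples (under A) w"
        using xs ys by (auto simp: tuples_iff nth_append)
      moreover have "?zs ! k = xs ! k" using len Suc.prems by (simp add: nth_append)
      moreover have "?zs[k := ys ! k] = take (Suc k) ys @ drop (Suc k) xs"
        using len Suc.prems
        by (intro nth_equalityI) (auto simp: nth_append nth_list_update less_Suc_eq min_def)
      ultimately have "(oper A w s \<sigma> ?zs, oper A w s \<sigma> (take (Suc k) ys @ drop (Suc k) xs)) \<in> (Q s)\<^sup>+"
        using step[OF w, of ?zs k "ys ! k"] xy Suc.prems by simp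
      with Suc show ?case by (meson Suc_leD trancl_trans)
    qed
    from this[of "length w"] show ?thesis using xs ys by (simp add: tuples_iff)
  qed
  have "equiv (under A s) ((Q s)\<^sup>+)" if "s \<in> S" for s
    using Tsub[OF that] refl[OF that] sym_trancl[OF symQ[OF that]]
    by (auto simp: equiv_def refl_on_def)
  with comp have "is_congruence S Sg A (\<lambda>s. (Q s)\<^sup>+)"
    unfolding is_congruence_def off_empty_def by (auto simp: off)
  then show ?thesis by (simp add: Q_def)
qed

text \<open>The join of all congruences saturating \<open>L\<close> still saturates
  \<open>L\<close>, since each link of a chain preserves membership in \<open>L\<close>. It is
  therefore the greatest one, and \<open>Omega\<close> is well defined.\<close>

lemma Omega_greatest:
  assumes cl: "op_closed S Sg A" and L: "L \<in> sorted_subsets S (under A)"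
  shows "is_congruence S Sg A (Omega S Sg A L)"
    and "saturated S A (Omega S Sg A L) L"
    and "\<And>\<Psi> s. is_congruence S Sg A \<Psi> \<Longrightarrow> saturated S A \<Psi> L \<Longrightarrow> s \<in> S \<Longrightarrow> \<Psi> s \<subseteq> Omega S Sg A L s"
proof -
  define G where "G = {\<Psi>. is_congruence S Sg A \<Psi> \<and> saturated S A \<Psi> L}"
  define \<Phi> where "\<Phi> s = (\<Union>\<Psi>\<in>G. \<Psi> s)\<^sup>+" for s
  have LA: "L s \<subseteq> under A s" if "s \<in> S" for s using L that by (auto simp: sorted_subsets_def)
  \<comment> \<open>The identity congruence saturates every sorted subset, which makes
    \<open>G\<close> nonempty.\<close>
  let ?I = "\<lambda>s. if s \<in> S then Id_on (under A s) else {}"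
  have I: "is_congruence S Sg A ?I"
    unfolding is_congruence_def
  proof (intro conjI ballI impI)
    fix w s \<sigma> xs ys
    assume w: "w \<in> lists S" "s \<in> S" "\<sigma> \<in> Sg w s" and xs: "xs \<in> tuples (under A) w"
      and ys: "ys \<in> tuples (under A) w"
      and "\<forall>i<length w. (xs ! i, ys ! i) \<in> (if w ! i \<in> S then Id_on (under A (w ! i)) else {})"
    then have "xs = ys" by (intro nth_equalityI) (auto simp: tuples_iff split: if_splits)
    then show "(oper A w s \<sigma> xs, oper A w s \<sigma> ys) \<in> (if s \<in> S then Id_on (under A s) else {})"
      using cl w xs by (auto simp: op_closed_def)
  qed (auto simp: off_empty_def equiv_def refl_on_def sym_def trans_def)
  have "saturated S A ?I L"
    using LA by (auto simp: saturated_iff[OF I])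
  then have ne: "G \<noteq> {}" using I by (auto simp: G_def)
  have \<Phi>: "is_congruence S Sg A \<Phi>"
    unfolding \<Phi>_def by (rule is_congruence_trancl_Union[OF _ ne]) (simp add: G_def)
  have sat: "saturated S A \<Phi> L"
    unfolding saturated_iff[OF \<Phi>]
  proof (intro ballI conjI LA subsetI)
    fix s y assume s: "s \<in> S" and "y \<in> \<Phi> s `` L s"
    then obtain x where x: "x \<in> L s" "(x, y) \<in> (\<Union>\<Psi>\<in>G. \<Psi> s)\<^sup>+"
      unfolding \<Phi>_def by blast
    have closed: "v \<in> L s" if uv: "(u, v) \<in> (\<Union>\<Psi>\<in>G. \<Psi> s)" and u: "u \<in> L s" for u v
    proof -
      from uv obtain \<Psi> where "\<Psi> \<in> G" and \<Psi>: "(u, v) \<in> \<Psi> s" by blast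
      then have "\<Psi> s `` L s \<subseteq> L s" using s saturated_iff[of S Sg A \<Psi> L] by (simp add: G_def)
      then show ?thesis using \<Psi> u by blast
    qed
    from x(2) show "y \<in> L s"
    proof (induction rule: trancl_induct)
      case (base y)
      then show ?case using x(1) by (rule closed)
    next
      case (step y z)
      then show ?case using closed by blast
    qed
  qed
  have gr: "\<Psi> s \<subseteq> \<Phi> s" if "is_congruence S Sg A \<Psi>" "saturated S A \<Psi> L" for \<Psi> s
  proof
    fix p assume "p \<in> \<Psi> s"
    then have "p \<in> (\<Union>\<Psi>\<in>G. \<Psi> s)" using that by (auto simp: G_def)
    then show "p \<in> \<Phi> s" unfolding \<Phi>_def by (rule r_into_trancl')
  qed
  have eq: "Omega S Sg A L = \<Phi>"
    unfolding Omega_def by (rule greatest_congruence_eq[where P = "\<lambda>\<Phi>. saturated S A \<Phi> L", OF \<Phi> sat]) (rule gr)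
  show "is_congruence S Sg A (Omega S Sg A L)" unfolding eq by (rule \<Phi>)
  show "saturated S A (Omega S Sg A L) L" unfolding eq by (rule sat)
  show "\<Psi> s \<subseteq> Omega S Sg A L s"
    if "is_congruence S Sg A \<Psi>" "saturated S A \<Psi> L" "s \<in> S" for \<Psi> s
    unfolding eq using that(1,2) by (rule gr)
qed

section \<open>Particular congruences: full relation, intersections, kernels\<close>

lemma is_congruence_full:
  assumes "op_closed S Sg A"
  shows "is_congruence S Sg A (\<lambda>s. if s \<in> S then under A s \<times> under A s else {})"
  unfolding is_congruence_def
proof (intro conjI ballI impI)
  fix w s \<sigma> xs ys
  assume "w \<in> lists S" "s \<in> S" "\<sigma> \<in> Sg w s" "xs \<in> tuples (under A) w" "ys \<in> tuples (under A) w"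
  with assms show "(oper A w s \<sigma> xs, oper A w s \<sigma> ys) \<in> (if s \<in> S then under A s \<times> under A s else {})"
    by (auto simp: op_closed_def)
qed (auto simp: off_empty_def equiv_def refl_on_def sym_def trans_def)

lemma nabla_eq:
  assumes cl: "op_closed S Sg A"
  shows "nabla S Sg A = (\<lambda>s. if s \<in> S then under A s \<times> under A s else {})"
  unfolding nabla_def
proof (rule greatest_congruence_eq[OF is_congruence_full[OF cl]])
  fix \<Psi> s assume "is_congruence S Sg A \<Psi>" "s \<in> S"
  then have "equiv (under A s) (\<Psi> s)" by (simp add: is_congruence_def)
  then show "\<Psi> s \<subseteq> (if s \<in> S then under A s \<times> under A s else {})"
    using \<open>s \<in> S\<close> by (auto simp: equiv_def refl_on_def)
qed simp

lemma is_congruence_Int: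
  assumes \<Phi>: "is_congruence S Sg A \<Phi>" and \<Psi>: "is_congruence S Sg A \<Psi>"
  shows "is_congruence S Sg A (\<lambda>s. \<Phi> s \<inter> \<Psi> s)"
  unfolding is_congruence_def
proof (intro conjI ballI impI)
  show "off_empty S (\<lambda>s. \<Phi> s \<inter> \<Psi> s)"
    using \<Phi> by (simp add: is_congruence_def off_empty_def)
  fix s assume "s \<in> S"
  then have "equiv (under A s) (\<Phi> s)" "equiv (under A s) (\<Psi> s)"
    using \<Phi> \<Psi> by (auto simp: is_congruence_def)
  then show "equiv (under A s) (\<Phi> s \<inter> \<Psi> s)"
    by (auto simp: equiv_def refl_on_def intro: sym_Int trans_Int)
next
  fix w s \<sigma> xs ys
  assume w: "w \<in> lists S" "s \<in> S" "\<sigma> \<in> Sg w s" "xs \<in> tuples (under A) w" "ys \<in> tuples (under A) w"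
    and eq: "\<forall>i<length w. (xs ! i, ys ! i) \<in> \<Phi> (w ! i) \<inter> \<Psi> (w ! i)"
  have "(oper A w s \<sigma> xs, oper A w s \<sigma> ys) \<in> \<Theta> s"
    if "is_congruence S Sg A \<Theta>" "\<forall>i<length w. (xs ! i, ys ! i) \<in> \<Theta> (w ! i)" for \<Theta>
    using that w unfolding is_congruence_def by blast
  from this[OF \<Phi>] this[OF \<Psi>] eq
  show "(oper A w s \<sigma> xs, oper A w s \<sigma> ys) \<in> \<Phi> s \<inter> \<Psi> s" by blast
qed

text \<open>Kernel-related argument lists have the same image under \<open>map2 f w\<close>, so the
  homomorphism equation gives results with equal images; \<open>op_closed\<close> keeps these
  results in the carrier.\<close>

lemma is_congruence_Ker:
  assumes cl: "op_closed S Sg A" and f: "homomorphism S Sg A B f"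
  shows "is_congruence S Sg A (Ker S A f)"
  unfolding is_congruence_def
proof (intro conjI ballI impI)
  show "off_empty S (Ker S A f)" by (auto simp: off_empty_def Ker_def)
  show "equiv (under A s) (Ker S A f s)" if "s \<in> S" for s
    using that by (auto simp: equiv_def refl_on_def sym_def trans_def Ker_def)
  fix w s \<sigma> xs ys
  assume w: "w \<in> lists S" "s \<in> S" "\<sigma> \<in> Sg w s"
    and xs: "xs \<in> tuples (under A) w" and ys: "ys \<in> tuples (under A) w"
    and eq: "\<forall>i<length w. (xs ! i, ys ! i) \<in> Ker S A f (w ! i)"
  have "map2 f w xs = map2 f w ys"
    using xs ys eq by (intro nth_equalityI) (auto simp: tuples_iff Ker_def)
  then have "f s (oper A w s \<sigma> xs) = f s (oper A w s \<sigma> ys)"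
    using f w xs ys unfolding homomorphism_def by metis
  then show "(oper A w s \<sigma> xs, oper A w s \<sigma> ys) \<in> Ker S A f s"
    using cl w xs ys by (auto simp: op_closed_def Ker_def)
qed


section \<open>Finite index\<close>

lemma finite_index_iff:
  "finite_index S A \<Phi> \<longleftrightarrow> finite (Sigma S (\<lambda>s. under A s // \<Phi> s))"
  by (simp add: finite_index_def sorted_finite_def quotient_alg_def)

text \<open>The class of \<open>x\<close> depends only on \<open>h s x\<close>, so the classes are
  an image of the finite set \<open>Sigma S Y\<close>. The finiteness results below differ only in
  the choice of \<open>h\<close> and \<open>Y\<close>.\<close>

lemma finite_index_if_kernel:
  assumes fin: "finite (Sigma S Y)"
    and h: "\<And>s x. s \<in> S \<Longrightarrow> x \<in> under A s \<Longrightarrow> h s x \<in> Y s"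
    and cong: "\<And>s x y. s \<in> S \<Longrightarrow> x \<in> under A s \<Longrightarrow> y \<in> under A s \<Longrightarrow> h s x = h s y \<Longrightarrow>
      \<Phi> s `` {x} = \<Phi> s `` {y}"
  shows "finite_index S A \<Phi>"
  unfolding finite_index_iff
proof (rule finite_surj[OF fin])
  \<comment> \<open>Sends a value to the class of a chosen preimage. Values that \<open>h\<close>
    does not attain yield something arbitrary, which is harmless because only an inclusion in the
    image is claimed.\<close>
  let ?g = "\<lambda>(s, z). (s, \<Phi> s `` {SOME x. x \<in> under A s \<and> h s x = z})"
  show "(SIGMA s:S. under A s // \<Phi> s) \<subseteq> ?g ` Sigma S Y"
  proof clarify
    fix s X assume s: "s \<in> S" and "X \<in> under A s // \<Phi> s"
    then obtain x where x: "x \<in> under A s" "X = \<Phi> s `` {x}" by (auto elim: quotientE)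
    let ?x' = "SOME x'. x' \<in> under A s \<and> h s x' = h s x"
    have "?x' \<in> under A s \<and> h s ?x' = h s x" by (rule someI[of _ x]) (use x in simp)
    then have "\<Phi> s `` {?x'} = X" using cong s x by blast
    then have "(s, X) = ?g (s, h s x)" by simp
    then show "(s, X) \<in> ?g ` Sigma S Y" using h s x by blast
  qed
qed

text \<open>A class of the finer congruence determines the class of the coarser one containing
  it.\<close>

lemma finite_index_mono:
  assumes fin: "finite_index S A \<Psi>"
    and \<Psi>: "is_congruence S Sg A \<Psi>" and \<Phi>: "is_congruence S Sg A \<Phi>"
    and sub: "\<And>s. s \<in> S \<Longrightarrow> \<Psi> s \<subseteq> \<Phi> s"
  shows "finite_index S A \<Phi>"
proof (rule finite_index_if_kernel[OF fin[unfolded finite_index_iff], where h = "proj \<Psi>"])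
  show "proj \<Psi> s x \<in> under A s // \<Psi> s" if "s \<in> S" "x \<in> under A s" for s x
    using that by (auto simp: proj_def intro: quotientI)
  fix s x y assume s: "s \<in> S" and xy: "x \<in> under A s" "y \<in> under A s" and eq: "proj \<Psi> s x = proj \<Psi> s y"
  have equ: "equiv (under A s) (\<Psi> s)" "equiv (under A s) (\<Phi> s)"
    using s \<Psi> \<Phi> by (auto simp: is_congruence_def)
  have "(x, y) \<in> \<Phi> s" using eq equ xy sub[OF s] by (auto simp: proj_def eq_equiv_class_iff)
  then show "\<Phi> s `` {x} = \<Phi> s `` {y}" using equ by (simp add: equiv_class_eq)
qed

lemma finite_index_Int:
  assumes fin: "finite_index S A \<Phi>" "finite_index S A \<Psi>"
    and \<Phi>: "is_congruence S Sg A \<Phi>" and \<Psi>: "is_congruence S Sg A \<Psi>"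
  shows "finite_index S A (\<lambda>s. \<Phi> s \<inter> \<Psi> s)"
proof (rule finite_index_if_kernel[where h = "\<lambda>s x. (\<Phi> s `` {x}, \<Psi> s `` {x})"])
  let ?Y = "\<lambda>s. (under A s // \<Phi> s) \<times> (under A s // \<Psi> s)"
  show "finite (Sigma S ?Y)"
  proof (rule finite_surj[OF finite_cartesian_product[OF fin[unfolded finite_index_iff]]])
    \<comment> \<open>The product also contains pairs with two different sorts; the map keeps the
      first sort, and each required triple arises from a pair with equal sorts.\<close>
    show "Sigma S ?Y \<subseteq> (\<lambda>(p, q). (fst p, snd p, snd q)) `
        ((SIGMA s:S. under A s // \<Phi> s) \<times> (SIGMA s:S. under A s // \<Psi> s))"
    proof clarify
      fix s X Y assume "s \<in> S" "X \<in> under A s // \<Phi> s" "Y \<in> under A s // \<Psi> s"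
      then show "(s, X, Y) \<in> (\<lambda>(p, q). (fst p, snd p, snd q)) `
          ((SIGMA s:S. under A s // \<Phi> s) \<times> (SIGMA s:S. under A s // \<Psi> s))"
        by (intro image_eqI[where x = "((s, X), (s, Y))"]) simp_all
    qed
  qed
  show "(\<Phi> s `` {x}, \<Psi> s `` {x}) \<in> ?Y s" if "s \<in> S" "x \<in> under A s" for s x
    using that by (auto intro: quotientI)
  show "(\<Phi> s \<inter> \<Psi> s) `` {x} = (\<Phi> s \<inter> \<Psi> s) `` {y}"
    if "(\<Phi> s `` {x}, \<Psi> s `` {x}) = (\<Phi> s `` {y}, \<Psi> s `` {y})" for s x y
    using that by blast
qed

lemma finite_index_Ker:
  assumes fin: "sorted_finite S (under B)" and f: "homomorphism S Sg A B f"
  shows "finite_index S A (Ker S A f)"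
proof (rule finite_index_if_kernel[OF fin[unfolded sorted_finite_def], where h = f])
  show "f s x \<in> under B s" if "s \<in> S" "x \<in> under A s" for s x
    using f that by (auto simp: homomorphism_def)
  show "Ker S A f s `` {x} = Ker S A f s `` {y}"
    if "x \<in> under A s" "y \<in> under A s" "f s x = f s y" for s x y
    using that by (auto simp: Ker_def)
qed

text \<open>There is one class for each sort in the support, so a finite support gives finite
  index.\<close>

lemma finite_index_nabla:
  assumes cl: "op_closed S Sg A" and fin: "finite (support S (under A))"
  shows "finite_index S A (nabla S Sg A)"
proof (rule finite_index_if_kernel[where h = "\<lambda>_ _. ()"])
  \<comment> \<open>The component at \<open>s\<close> is a singleton or empty according to whether
    the carrier is inhabited, so the sum is a copy of the support.\<close>
  show "finite (Sigma S (\<lambda>s. {_ :: unit. under A s \<noteq> {}}))"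
  proof (rule finite_subset)
    show "Sigma S (\<lambda>s. {_ :: unit. under A s \<noteq> {}}) \<subseteq> support S (under A) \<times> UNIV"
      by (auto simp: support_def)
  qed (use fin in simp)
qed (auto simp: nabla_eq[OF cl])

text \<open>If \<open>\<Phi>\<close> saturates \<open>L\<close>, then \<open>Omega\<close> of
  \<open>L\<close> contains \<open>\<Phi>\<close> and inherits finite index from it. Regularity thus
  reduces to finite index of the saturating congruence.\<close>

lemma Sat_subset_Lang_r:
  assumes cl: "op_closed S Sg A" and \<Phi>: "is_congruence S Sg A \<Phi>" and fin: "finite_index S A \<Phi>"
  shows "Sat S A \<Phi> \<subseteq> Lang_r S Sg A"
proof
  fix L assume "L \<in> Sat S A \<Phi>"
  then have L: "L \<in> sorted_subsets S (under A)" "saturated S A \<Phi> L" by (auto simp: Sat_def)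
  have "finite_index S A (Omega S Sg A L)"
    using fin \<Phi> Omega_greatest(1)[OF cl L(1)] Omega_greatest(3)[OF cl L(1) \<Phi> L(2)]
    by (rule finite_index_mono)
  then show "L \<in> Lang_r S Sg A" using L(1) by (simp add: Lang_r_def)
qed


section \<open>The lattice of formations\<close>

text \<open>An elementwise form of the closure conditions. The restriction provides extensionality,
  so the premises can speak of the unrestricted \<open>F\<close>.\<close>

lemma formationsI:
  assumes "\<And>A L. A \<in> sorted_sets U S \<Longrightarrow> L \<in> F A \<Longrightarrow> L \<in> Lang_r S Sg (free_alg S Sg A)"
    and "\<And>A K. A \<in> sorted_sets U S \<Longrightarrow> K \<in> Sat S (free_alg S Sg A) (nabla S Sg (free_alg S Sg A)) \<Longrightarrow> K \<in> F A"
    and "\<And>A L L' K. A \<in> sorted_sets U S \<Longrightarrow> L \<in> F A \<Longrightarrow> L' \<in> F A \<Longrightarrow>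
      K \<in> Sat S (free_alg S Sg A)
        (\<lambda>s. Omega S Sg (free_alg S Sg A) L s \<inter> Omega S Sg (free_alg S Sg A) L' s) \<Longrightarrow> K \<in> F A"
    and "\<And>A B M f K. A \<in> sorted_sets U S \<Longrightarrow> B \<in> sorted_sets U S \<Longrightarrow> M \<in> F B \<Longrightarrow>
      homomorphism S Sg (free_alg S Sg A) (free_alg S Sg B) f \<Longrightarrow>
      epimorphism S Sg (free_alg S Sg A) (quotient_alg (free_alg S Sg B) (Omega S Sg (free_alg S Sg B) M))
        (\<lambda>s. proj (Omega S Sg (free_alg S Sg B) M) s \<circ> f s) \<Longrightarrow>
      K \<in> Sat S (free_alg S Sg A)
        (Ker S (free_alg S Sg A) (\<lambda>s. proj (Omega S Sg (free_alg S Sg B) M) s \<circ> f s)) \<Longrightarrow> K \<in> F A"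
  shows "(\<lambda>A\<in>sorted_sets U S. F A) \<in> formations U S Sg"
  unfolding formations_def Let_def mem_Collect_eq
  by (intro conjI ballI allI impI subsetI; simp only: restrict_extensional restrict_apply') (fact assms)+

lemma formationsD:
  assumes "\<L> \<in> formations U S Sg" "A \<in> sorted_sets U S"
  shows "L \<in> \<L> A \<Longrightarrow> L \<in> Lang_r S Sg (free_alg S Sg A)"
    and "K \<in> Sat S (free_alg S Sg A) (nabla S Sg (free_alg S Sg A)) \<Longrightarrow> K \<in> \<L> A"
    and "L \<in> \<L> A \<Longrightarrow> L' \<in> \<L> A \<Longrightarrow>
      K \<in> Sat S (free_alg S Sg A)
        (\<lambda>s. Omega S Sg (free_alg S Sg A) L s \<inter> Omega S Sg (free_alg S Sg A) L' s) \<Longrightarrow> K \<in> \<L> A"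
    and "B \<in> sorted_sets U S \<Longrightarrow> M \<in> \<L> B \<Longrightarrow>
      homomorphism S Sg (free_alg S Sg A) (free_alg S Sg B) f \<Longrightarrow>
      epimorphism S Sg (free_alg S Sg A) (quotient_alg (free_alg S Sg B) (Omega S Sg (free_alg S Sg B) M))
        (\<lambda>s. proj (Omega S Sg (free_alg S Sg B) M) s \<circ> f s) \<Longrightarrow>
      K \<in> Sat S (free_alg S Sg A)
        (Ker S (free_alg S Sg A) (\<lambda>s. proj (Omega S Sg (free_alg S Sg B) M) s \<circ> f s)) \<Longrightarrow> K \<in> \<L> A"
  using assms unfolding formations_def Let_def by blast+

text \<open>Provides the greatest formation. Each closure condition produces a congruence of finite
  index: \<open>nabla\<close> by finite support, an intersection of two such congruences, or the
  kernel of a map into a finite quotient.\<close>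

lemma Lang_r_formation:
  assumes fin: "\<And>A. A \<in> sorted_sets U S \<Longrightarrow> finite (support S (under (free_alg S Sg A)))"
  shows "(\<lambda>A\<in>sorted_sets U S. Lang_r S Sg (free_alg S Sg A)) \<in> formations U S Sg"
proof -
  note cl = op_closed_free_alg[of S Sg]
  have Omega: "is_congruence S Sg (free_alg S Sg A) (Omega S Sg (free_alg S Sg A) L)"
      "finite_index S (free_alg S Sg A) (Omega S Sg (free_alg S Sg A) L)"
    if "L \<in> Lang_r S Sg (free_alg S Sg A)" for A L
    using that Omega_greatest(1)[OF cl] by (auto simp: Lang_r_def)
  have nab: "Sat S (free_alg S Sg A) (nabla S Sg (free_alg S Sg A)) \<subseteq> Lang_r S Sg (free_alg S Sg A)"
    if "A \<in> sorted_sets U S" for A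
    using that by (intro Sat_subset_Lang_r cl finite_index_nabla fin)
      (simp add: nabla_eq[OF cl] is_congruence_full[OF cl])
  have int: "Sat S (free_alg S Sg A)
      (\<lambda>s. Omega S Sg (free_alg S Sg A) L s \<inter> Omega S Sg (free_alg S Sg A) L' s)
      \<subseteq> Lang_r S Sg (free_alg S Sg A)"
    if "L \<in> Lang_r S Sg (free_alg S Sg A)" "L' \<in> Lang_r S Sg (free_alg S Sg A)" for A L L'
    using Omega[OF that(1)] Omega[OF that(2)]
    by (intro Sat_subset_Lang_r[OF cl] is_congruence_Int finite_index_Int)
  have ker: "Sat S (free_alg S Sg A) (Ker S (free_alg S Sg A) g) \<subseteq> Lang_r S Sg (free_alg S Sg A)"
    if M: "M \<in> Lang_r S Sg (free_alg S Sg B)"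
      and g: "epimorphism S Sg (free_alg S Sg A)
        (quotient_alg (free_alg S Sg B) (Omega S Sg (free_alg S Sg B) M)) g" for A B M g
  proof (rule Sat_subset_Lang_r[OF cl])
    have g': "homomorphism S Sg (free_alg S Sg A)
        (quotient_alg (free_alg S Sg B) (Omega S Sg (free_alg S Sg B) M)) g"
      using g by (simp add: epimorphism_def)
    show "is_congruence S Sg (free_alg S Sg A) (Ker S (free_alg S Sg A) g)"
      by (rule is_congruence_Ker[OF cl g'])
    show "finite_index S (free_alg S Sg A) (Ker S (free_alg S Sg A) g)"
      \<comment> \<open>Finite index of \<open>Omega\<close> of \<open>M\<close> means by definition
        that the quotient, the codomain of \<open>g\<close>, is finite.\<close>
      by (rule finite_index_Ker[OF Omega(2)[OF M, unfolded finite_index_def] g'])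
  qed
  show ?thesis
    by (rule formationsI) (use nab int ker in blast)+
qed

lemma formations_Inter:
  assumes X: "X \<subseteq> formations U S Sg" and ne: "X \<noteq> {}"
  shows "(\<lambda>A\<in>sorted_sets U S. \<Inter>\<L>\<in>X. \<L> A) \<in> formations U S Sg"
proof (rule formationsI)
  note D = formationsD[OF subsetD[OF X]]
  show "L \<in> Lang_r S Sg (free_alg S Sg A)" if "A \<in> sorted_sets U S" "L \<in> (\<Inter>\<L>\<in>X. \<L> A)" for A L
    \<comment> \<open>Regularity is inherited from any one member of the family, and
      \<open>ne\<close> provides one.\<close>
    using that ne D(1) by blast
qed (rule INT_I, (rule formationsD(2-4)[OF subsetD[OF X]]; (assumption | erule (1) INT_D)))+

text \<open>Directedness serves the intersection condition, whose two languages may come from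
  different members. The epimorphism condition starts from a single language, and the
  \<open>nabla\<close> condition holds in any member.\<close>

lemma formations_directed_Union:
  assumes X: "X \<subseteq> formations U S Sg" and ne: "X \<noteq> {}"
    and dir: "\<And>\<L> \<M>. \<L> \<in> X \<Longrightarrow> \<M> \<in> X \<Longrightarrow> \<exists>\<N>\<in>X. \<forall>A\<in>sorted_sets U S. \<L> A \<subseteq> \<N> A \<and> \<M> A \<subseteq> \<N> A"
  shows "(\<lambda>A\<in>sorted_sets U S. \<Union>\<L>\<in>X. \<L> A) \<in> formations U S Sg"
proof (rule formationsI)
  note D = formationsD[OF subsetD[OF X]]
  fix A assume A: "A \<in> sorted_sets U S"
  show "L \<in> Lang_r S Sg (free_alg S Sg A)" if "L \<in> (\<Union>\<L>\<in>X. \<L> A)" for L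
    using that D(1)[OF _ A] by blast
  show "K \<in> (\<Union>\<L>\<in>X. \<L> A)" if "K \<in> Sat S (free_alg S Sg A) (nabla S Sg (free_alg S Sg A))" for K
    using that ne D(2)[OF _ A] by blast
  show "K \<in> (\<Union>\<L>\<in>X. \<L> A)"
    if L: "L \<in> (\<Union>\<L>\<in>X. \<L> A)" "L' \<in> (\<Union>\<L>\<in>X. \<L> A)"
      and K: "K \<in> Sat S (free_alg S Sg A)
        (\<lambda>s. Omega S Sg (free_alg S Sg A) L s \<inter> Omega S Sg (free_alg S Sg A) L' s)" for L L' K
  proof -
    from L obtain \<L> \<M> where "\<L> \<in> X" "\<M> \<in> X" "L \<in> \<L> A" "L' \<in> \<M> A" by blast
    \<comment> \<open>A common upper bound contains both languages, so its own closure condition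
      applies.\<close>
    with dir[of \<L> \<M>] A obtain \<N> where "\<N> \<in> X" "L \<in> \<N> A" "L' \<in> \<N> A" by blast
    with D(3)[OF _ A _ _ K] show ?thesis by blast
  qed
  show "K \<in> (\<Union>\<L>\<in>X. \<L> A)"
    if B: "B \<in> sorted_sets U S" and M: "M \<in> (\<Union>\<L>\<in>X. \<L> B)"
      and f: "homomorphism S Sg (free_alg S Sg A) (free_alg S Sg B) f"
        "epimorphism S Sg (free_alg S Sg A) (quotient_alg (free_alg S Sg B) (Omega S Sg (free_alg S Sg B) M))
          (\<lambda>s. proj (Omega S Sg (free_alg S Sg B) M) s \<circ> f s)"
        "K \<in> Sat S (free_alg S Sg A)
          (Ker S (free_alg S Sg A) (\<lambda>s. proj (Omega S Sg (free_alg S Sg B) M) s \<circ> f s))" for B M f K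
    using M D(4)[OF _ A B _ f] by blast
qed

theorem corollary6p24:
  fixes elts :: "'u \<Rightarrow> 'u set"
    and S :: "'u set"
    and Sg :: "'u list \<Rightarrow> 'u \<Rightarrow> 'u set"
  assumes "grothendieck_universe elts"
    and "S \<in> range elts"
    and "\<forall>w\<in>lists S. \<forall>s\<in>S. Sg w s \<in> range elts"
    and "\<forall>A\<in>sorted_sets (range elts) S. finite (support S (under (free_alg S Sg A)))"
  shows "algebraic_lattice (Form (range elts) S Sg)"
  unfolding Form_def
proof (rule algebraic_lattice_pointwise)
  show "formations (range elts) S Sg \<subseteq> extensional (sorted_sets (range elts) S)"
    by (auto simp: formations_def)
  \<comment> \<open>This fixes the witness for \<open>T\<close>; finiteness of the supports enters
    here.\<close>
  show "(\<lambda>A\<in>sorted_sets (range elts) S. Lang_r S Sg (free_alg S Sg A)) \<in> formations (range elts) S Sg"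
    using assms(4) by (intro Lang_r_formation) blast
  show "\<L> A \<subseteq> (\<lambda>A\<in>sorted_sets (range elts) S. Lang_r S Sg (free_alg S Sg A)) A"
    if "\<L> \<in> formations (range elts) S Sg" "A \<in> sorted_sets (range elts) S" for \<L> A
    using that formationsD(1)[OF that] by auto
qed (fact formations_Inter formations_directed_Union)+

end
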